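(* $\mathrm{KT}(\aleph_1)$ implies $\mathfrak{mcf}=\aleph_1$.
   Context: All ultrafilters are nonprincipal. For a cardinal $\kappa$, $\mathrm{KT}(\kappa)$ is the statement: for every countable first-order language $L$ and all $L$-structures $\mathcal{A},\mathcal{B}$ of size $\le\kappa$ with $\mathcal{A}\equiv\mathcal{B}$, there exists a nonprincipal ultrafilter $U$ over $\omega$ such that $\mathcal{A}^\omega/U\cong\mathcal{B}^\omega/U$. The cardinal $\mathfrak{mcf}$ is $\min\{\operatorname{cf}(\omega^\omega/U,<_U): U \text{ a nonprincipal ultrafilter over }\omega\}$, where $[f]<_U[g]$ iff $\{n: f(n)<g(n)\}\in U$. *)

theory Defs
  imports Main "HOL-Library.Countable_Set"
begin

unbundle cardinal_syntax

section \<open>First-order languages, structures and satisfaction\<close>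

text \<open>Constants are function symbols of arity 0.\<close>

record ('f, 'r) language =
  funs :: "'f set"
  rels :: "'r set"
  fun_arity :: "'f \<Rightarrow> nat"
  rel_arity :: "'r \<Rightarrow> nat"

definition countable_language :: "('f, 'r) language \<Rightarrow> bool" where
  "countable_language L \<longleftrightarrow> countable (funs L) \<and> countable (rels L)"

datatype 'f fo_term = Var nat | Fun 'f "'f fo_term list"

datatype ('f, 'r) fo_form =
    Equal "'f fo_term" "'f fo_term"
  | Rel 'r "'f fo_term list"
  | Neg "('f, 'r) fo_form"
  | Conj "('f, 'r) fo_form" "('f, 'r) fo_form"
  | Exists nat "('f, 'r) fo_form"

primrec term_of_lang :: "('f, 'r) language \<Rightarrow> 'f fo_term \<Rightarrow> bool" where
  "term_of_lang L (Var v) \<longleftrightarrow> True"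
| "term_of_lang L (Fun f ts) \<longleftrightarrow>
     f \<in> funs L \<and> length ts = fun_arity L f \<and> list_all (term_of_lang L) ts"

primrec form_of_lang :: "('f, 'r) language \<Rightarrow> ('f, 'r) fo_form \<Rightarrow> bool" where
  "form_of_lang L (Equal s t) \<longleftrightarrow> term_of_lang L s \<and> term_of_lang L t"
| "form_of_lang L (Rel r ts) \<longleftrightarrow>
     r \<in> rels L \<and> length ts = rel_arity L r \<and> list_all (term_of_lang L) ts"
| "form_of_lang L (Neg p) \<longleftrightarrow> form_of_lang L p"
| "form_of_lang L (Conj p q) \<longleftrightarrow> form_of_lang L p \<and> form_of_lang L q"
| "form_of_lang L (Exists v p) \<longleftrightarrow> form_of_lang L p"

primrec term_vars :: "'f fo_term \<Rightarrow> nat set" where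
  "term_vars (Var v) = {v}"
| "term_vars (Fun f ts) = \<Union> (set (map term_vars ts))"

primrec free_vars :: "('f, 'r) fo_form \<Rightarrow> nat set" where
  "free_vars (Equal s t) = term_vars s \<union> term_vars t"
| "free_vars (Rel r ts) = \<Union> (set (map term_vars ts))"
| "free_vars (Neg p) = free_vars p"
| "free_vars (Conj p q) = free_vars p \<union> free_vars q"
| "free_vars (Exists v p) = free_vars p - {v}"

definition sentences :: "('f, 'r) language \<Rightarrow> ('f, 'r) fo_form set" where
  "sentences L = {p. form_of_lang L p \<and> free_vars p = {}}"

record ('f, 'r, 'a) fo_structure =
  universe :: "'a set"
  fun_interp :: "'f \<Rightarrow> 'a list \<Rightarrow> 'a"
  rel_interp :: "'r \<Rightarrow> 'a list \<Rightarrow> bool"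

text \<open>Only the values of the interpretations at symbols of the language and at argument lists of
  the right length over the universe are meaningful.\<close>

definition is_structure :: "('f, 'r) language \<Rightarrow> ('f, 'r, 'a) fo_structure \<Rightarrow> bool" where
  "is_structure L M \<longleftrightarrow> universe M \<noteq> {} \<and>
     (\<forall>f\<in>funs L. \<forall>xs. length xs = fun_arity L f \<and> set xs \<subseteq> universe M
        \<longrightarrow> fun_interp M f xs \<in> universe M)"

primrec term_val :: "('f, 'r, 'a) fo_structure \<Rightarrow> (nat \<Rightarrow> 'a) \<Rightarrow> 'f fo_term \<Rightarrow> 'a" where
  "term_val M e (Var v) = e v"
| "term_val M e (Fun f ts) = fun_interp M f (map (term_val M e) ts)"

primrec sat :: "('f, 'r, 'a) fo_structure \<Rightarrow> (nat \<Rightarrow> 'a) \<Rightarrow> ('f, 'r) fo_form \<Rightarrow> bool" where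
  "sat M e (Equal s t) \<longleftrightarrow> term_val M e s = term_val M e t"
| "sat M e (Rel r ts) \<longleftrightarrow> rel_interp M r (map (term_val M e) ts)"
| "sat M e (Neg p) \<longleftrightarrow> \<not> sat M e p"
| "sat M e (Conj p q) \<longleftrightarrow> sat M e p \<and> sat M e q"
| "sat M e (Exists v p) \<longleftrightarrow> (\<exists>a\<in>universe M. sat M (e(v := a)) p)"

definition models :: "('f, 'r, 'a) fo_structure \<Rightarrow> ('f, 'r) fo_form \<Rightarrow> bool" where
  "models M p \<longleftrightarrow> (\<forall>e. range e \<subseteq> universe M \<longrightarrow> sat M e p)"

definition elem_equiv ::
  "('f, 'r) language \<Rightarrow> ('f, 'r, 'a) fo_structure \<Rightarrow> ('f, 'r, 'b) fo_structure \<Rightarrow> bool" where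
  "elem_equiv L M N \<longleftrightarrow> (\<forall>p\<in>sentences L. models M p \<longleftrightarrow> models N p)"

definition is_iso ::
  "('f, 'r) language \<Rightarrow> ('a \<Rightarrow> 'b) \<Rightarrow> ('f, 'r, 'a) fo_structure \<Rightarrow> ('f, 'r, 'b) fo_structure \<Rightarrow> bool"
where
  "is_iso L h M N \<longleftrightarrow> bij_betw h (universe M) (universe N) \<and>
     (\<forall>f\<in>funs L. \<forall>xs. length xs = fun_arity L f \<and> set xs \<subseteq> universe M
        \<longrightarrow> h (fun_interp M f xs) = fun_interp N f (map h xs)) \<and>
     (\<forall>r\<in>rels L. \<forall>xs. length xs = rel_arity L r \<and> set xs \<subseteq> universe M
        \<longrightarrow> (rel_interp M r xs \<longleftrightarrow> rel_interp N r (map h xs)))"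

definition isomorphic ::
  "('f, 'r) language \<Rightarrow> ('f, 'r, 'a) fo_structure \<Rightarrow> ('f, 'r, 'b) fo_structure \<Rightarrow> bool" where
  "isomorphic L M N \<longleftrightarrow> (\<exists>h. is_iso L h M N)"


section \<open>Ultrafilters and ultrapowers\<close>

definition ultrafilter :: "'i filter \<Rightarrow> bool" where
  "ultrafilter U \<longleftrightarrow> U \<noteq> bot \<and> (\<forall>P. eventually P U \<or> eventually (\<lambda>i. \<not> P i) U)"

definition nonprincipal_ultrafilter :: "'i filter \<Rightarrow> bool" where
  "nonprincipal_ultrafilter U \<longleftrightarrow> ultrafilter U \<and> (\<forall>i. U \<noteq> principal {i})"

definition ultra_rel :: "'i filter \<Rightarrow> 'a set \<Rightarrow> (('i \<Rightarrow> 'a) \<times> ('i \<Rightarrow> 'a)) set" where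
  "ultra_rel U A =
     {(x, y). range x \<subseteq> A \<and> range y \<subseteq> A \<and> eventually (\<lambda>i. x i = y i) U}"

definition ultra_carrier :: "'i filter \<Rightarrow> 'a set \<Rightarrow> ('i \<Rightarrow> 'a) set set" where
  "ultra_carrier U A = {x. range x \<subseteq> A} // ultra_rel U A"

definition ultra_rep :: "('i \<Rightarrow> 'a) set \<Rightarrow> 'i \<Rightarrow> 'a" where
  "ultra_rep c = (SOME x. x \<in> c)"

text \<open>The interpretations do not depend on the chosen representatives; see the lemmas
  \<open>ultrapower_fun\<close> and \<open>ultrapower_rel\<close> below.\<close>

definition ultrapower ::
  "'i filter \<Rightarrow> ('f, 'r, 'a) fo_structure \<Rightarrow> ('f, 'r, ('i \<Rightarrow> 'a) set) fo_structure" where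
  "ultrapower U M =
    \<lparr> universe = ultra_carrier U (universe M),
      fun_interp = (\<lambda>f cs. ultra_rel U (universe M) ``
                     {\<lambda>i. fun_interp M f (map (\<lambda>c. ultra_rep c i) cs)}),
      rel_interp = (\<lambda>r cs. eventually (\<lambda>i. rel_interp M r (map (\<lambda>c. ultra_rep c i) cs)) U) \<rparr>"


section \<open>The principle KT\<close>

text \<open>A formula cannot quantify over types. So the symbols are taken from \<open>nat\<close> and the universes
  are subsets of the type underlying \<open>\<kappa>\<close>; up to renaming of symbols and isomorphism these are all
  countable languages and all structures of size at most \<open>\<kappa>\<close>. Lemma \<open>KT_general\<close> below derives
  the statement for arbitrary symbol and element types.\<close>

definition KT :: "'a rel \<Rightarrow> bool" where
  "KT \<kappa> \<longleftrightarrow>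
    (\<forall>(L :: (nat, nat) language)
      (A :: (nat, nat, 'a) fo_structure) (B :: (nat, nat, 'a) fo_structure).
        countable_language L \<and> is_structure L A \<and> is_structure L B \<and>
        |universe A| \<le>o \<kappa> \<and> |universe B| \<le>o \<kappa> \<and> elem_equiv L A B
        \<longrightarrow> (\<exists>U :: nat filter. nonprincipal_ultrafilter U \<and>
               isomorphic L (ultrapower U A) (ultrapower U B)))"


section \<open>The cardinal mcf\<close>

text \<open>Determined only up to \<open>=o\<close>. The minimum exists for every nonempty set of cardinals
  by \<open>exists_minim_Card_order\<close>.\<close>

definition min_card :: "'a rel set \<Rightarrow> 'a rel" where
  "min_card R = (SOME r. r \<in> R \<and> (\<forall>s\<in>R. r \<le>o s))"

definition cofinality :: "'a set \<Rightarrow> ('a \<Rightarrow> 'a \<Rightarrow> bool) \<Rightarrow> 'a rel" where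
  "cofinality A lt =
     min_card {|X| | X. X \<subseteq> A \<and> (\<forall>a\<in>A. \<exists>x\<in>X. a = x \<or> lt a x)}"

definition ultra_less :: "nat filter \<Rightarrow> (nat \<Rightarrow> nat) set \<Rightarrow> (nat \<Rightarrow> nat) set \<Rightarrow> bool" where
  "ultra_less U c d \<longleftrightarrow> (\<exists>f\<in>c. \<exists>g\<in>d. eventually (\<lambda>n. f n < g n) U)"

definition mcf :: "(nat \<Rightarrow> nat) set rel" where
  "mcf = min_card {cofinality (ultra_carrier U UNIV) (ultra_less U) | U.
                     nonprincipal_ultrafilter U}"


section \<open>Adequacy of the definitions\<close>

lemma min_card:
  assumes "R \<noteq> {}" "\<And>r. r \<in> R \<Longrightarrow> Card_order r"
  shows "min_card R \<in> R \<and> (\<forall>s\<in>R. min_card R \<le>o s)"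
proof -
  have "\<exists>r. r \<in> R \<and> (\<forall>s\<in>R. r \<le>o s)"
    using exists_minim_Card_order[of R] assms by blast
  then show ?thesis unfolding min_card_def by (rule someI_ex)
qed

lemma ultra_less_class:
  "ultra_less U (ultra_rel U UNIV `` {f}) (ultra_rel U UNIV `` {g}) \<longleftrightarrow>
     eventually (\<lambda>n. f n < g n) U"
proof
  assume "ultra_less U (ultra_rel U UNIV `` {f}) (ultra_rel U UNIV `` {g})"
  then obtain f' g' where "eventually (\<lambda>n. f n = f' n) U" "eventually (\<lambda>n. g n = g' n) U"
    "eventually (\<lambda>n. f' n < g' n) U"
    unfolding ultra_less_def ultra_rel_def by auto
  then show "eventually (\<lambda>n. f n < g n) U" by eventually_elim simp
next
  assume "eventually (\<lambda>n. f n < g n) U"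
  then show "ultra_less U (ultra_rel U UNIV `` {f}) (ultra_rel U UNIV `` {g})"
    unfolding ultra_less_def ultra_rel_def by force
qed

lemma equiv_ultra_rel: "equiv {x. range x \<subseteq> A} (ultra_rel U A)"
proof (rule equivI)
  show "ultra_rel U A \<subseteq> {x. range x \<subseteq> A} \<times> {x. range x \<subseteq> A}"
    unfolding ultra_rel_def by auto
  show "refl_on {x. range x \<subseteq> A} (ultra_rel U A)"
    unfolding ultra_rel_def refl_on_def by auto
  show "sym (ultra_rel U A)"
    unfolding ultra_rel_def sym_def by (auto elim: eventually_mono)
  show "trans (ultra_rel U A)"
    unfolding ultra_rel_def trans_def by (auto elim: eventually_elim2)
qed

lemma ultra_rep_in: "c \<in> ultra_carrier U A \<Longrightarrow> ultra_rep c \<in> c"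
  unfolding ultra_rep_def ultra_carrier_def
  using in_quotient_imp_non_empty[OF equiv_ultra_rel[of A U]] by (metis some_in_eq)

lemma ultra_rep_range: "c \<in> ultra_carrier U A \<Longrightarrow> ultra_rep c i \<in> A"
  using ultra_rep_in[of c U A] unfolding ultra_carrier_def quotient_def ultra_rel_def by auto

lemma ultra_class_rep: "c \<in> ultra_carrier U A \<Longrightarrow> ultra_rel U A `` {ultra_rep c} = c"
  using ultra_rep_in[of c U A] equiv_ultra_rel[of A U] unfolding ultra_carrier_def
  by (metis Image_singleton_iff equiv_class_eq quotientE)

lemma ultra_class_in: "(\<And>i. x i \<in> A) \<Longrightarrow> ultra_rel U A `` {x} \<in> ultra_carrier U A"
  unfolding ultra_carrier_def by (rule quotientI) auto

lemma ultra_class_eqI: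
  assumes "\<And>i. x i \<in> A" "\<And>i. y i \<in> A" "eventually (\<lambda>i. x i = y i) U"
  shows "ultra_rel U A `` {x} = ultra_rel U A `` {y}"
  by (rule equiv_class_eq[OF equiv_ultra_rel]) (use assms in \<open>auto simp: ultra_rel_def\<close>)

lemma ultra_rep_class:
  assumes "\<And>i. x i \<in> A"
  shows "eventually (\<lambda>i. ultra_rep (ultra_rel U A `` {x}) i = x i) U"
proof -
  have "ultra_rep (ultra_rel U A `` {x}) \<in> ultra_rel U A `` {x}"
    using ultra_rep_in ultra_class_in assms by metis
  then show ?thesis unfolding ultra_rel_def by (auto elim: eventually_mono)
qed

lemma map_ultra_rep:
  assumes "\<And>x i. x \<in> set xs \<Longrightarrow> x i \<in> A"
  shows "eventually (\<lambda>i. map (\<lambda>c. ultra_rep c i) (map (\<lambda>x. ultra_rel U A `` {x}) xs)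
                          = map (\<lambda>x. x i) xs) U"
proof -
  have "eventually (\<lambda>i. \<forall>x\<in>set xs. ultra_rep (ultra_rel U A `` {x}) i = x i) U"
    using assms by (intro eventually_ball_finite) (auto intro: ultra_rep_class)
  then show ?thesis by eventually_elim simp
qed

lemma ultrapower_fun:
  assumes M: "is_structure L M" and f: "f \<in> funs L" "length xs = fun_arity L f"
    and xs: "\<And>x i. x \<in> set xs \<Longrightarrow> x i \<in> universe M"
  shows "fun_interp (ultrapower U M) f (map (\<lambda>x. ultra_rel U (universe M) `` {x}) xs)
       = ultra_rel U (universe M) `` {\<lambda>i. fun_interp M f (map (\<lambda>x. x i) xs)}"
proof -
  let ?cs = "map (\<lambda>x. ultra_rel U (universe M) `` {x}) xs"
  have "c \<in> ultra_carrier U (universe M)" if "c \<in> set ?cs" for c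
    using that xs by (auto intro: ultra_class_in)
  then have rep: "set (map (\<lambda>c. ultra_rep c i) ?cs) \<subseteq> universe M" for i
    by (auto intro: ultra_rep_range)
  have ev: "eventually (\<lambda>i. map (\<lambda>c. ultra_rep c i) ?cs = map (\<lambda>x. x i) xs) U"
    using xs by (rule map_ultra_rep)
  show ?thesis unfolding ultrapower_def fo_structure.simps
  proof (rule ultra_class_eqI)
    show "fun_interp M f (map (\<lambda>c. ultra_rep c i) ?cs) \<in> universe M" for i
      using M f rep[of i] unfolding is_structure_def by simp
    show "fun_interp M f (map (\<lambda>x. x i) xs) \<in> universe M" for i
    proof -
      have "set (map (\<lambda>x. x i) xs) \<subseteq> universe M" using xs by auto
      then show ?thesis using M f unfolding is_structure_def by simp
    qed
    show "eventually (\<lambda>i. fun_interp M f (map (\<lambda>c. ultra_rep c i) ?cs)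
                        = fun_interp M f (map (\<lambda>x. x i) xs)) U"
      using ev by eventually_elim (simp only:)
  qed
qed

lemma ultrapower_rel:
  assumes xs: "\<And>x i. x \<in> set xs \<Longrightarrow> x i \<in> universe M"
  shows "rel_interp (ultrapower U M) r (map (\<lambda>x. ultra_rel U (universe M) `` {x}) xs)
     \<longleftrightarrow> eventually (\<lambda>i. rel_interp M r (map (\<lambda>x. x i) xs)) U"
proof -
  let ?cs = "map (\<lambda>x. ultra_rel U (universe M) `` {x}) xs"
  have ev: "eventually (\<lambda>i. map (\<lambda>c. ultra_rep c i) ?cs = map (\<lambda>x. x i) xs) U"
    using xs by (rule map_ultra_rep)
  have "eventually (\<lambda>i. rel_interp M r (map (\<lambda>c. ultra_rep c i) ?cs)
                     = rel_interp M r (map (\<lambda>x. x i) xs)) U"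
    using ev by eventually_elim (simp only:)
  then show ?thesis unfolding ultrapower_def fo_structure.simps by (rule eventually_subst)
qed

lemma universe_ultrapower [simp]: "universe (ultrapower U M) = ultra_carrier U (universe M)"
  by (simp add: ultrapower_def)

lemma is_structure_ultrapower:
  assumes "is_structure L M"
  shows "is_structure L (ultrapower U M)"
proof -
  obtain a where a: "a \<in> universe M" using assms unfolding is_structure_def by auto
  have "ultra_rel U (universe M) `` {\<lambda>_. a} \<in> ultra_carrier U (universe M)"
    by (rule ultra_class_in) (rule a)
  then have "ultra_carrier U (universe M) \<noteq> {}" by (metis empty_iff)
  moreover have "fun_interp (ultrapower U M) f cs \<in> ultra_carrier U (universe M)"
    if f: "f \<in> funs L" and l: "length cs = fun_arity L f"
      and cs: "set cs \<subseteq> ultra_carrier U (universe M)" for f cs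
  proof -
    have "set (map (\<lambda>c. ultra_rep c i) cs) \<subseteq> universe M" for i
      using cs by (auto intro: ultra_rep_range)
    then show ?thesis unfolding ultrapower_def fo_structure.simps
      using assms f l by (intro ultra_class_in) (simp add: is_structure_def)
  qed
  ultimately show ?thesis unfolding is_structure_def by auto
qed

lemma is_iso_sym:
  assumes M: "is_structure L M" and iso: "is_iso L h M N"
  shows "is_iso L (inv_into (universe M) h) N M"
proof -
  let ?g = "inv_into (universe M) h"
  have bij: "bij_betw h (universe M) (universe N)" using iso unfolding is_iso_def by blast
  have img: "h ` universe M = universe N" and inj: "inj_on h (universe M)"
    using bij unfolding bij_betw_def by auto
  have g: "?g y \<in> universe M" "h (?g y) = y" if "y \<in> universe N" for y
    using that img by (auto intro: inv_into_into f_inv_into_f)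
  have mp: "set (map ?g ys) \<subseteq> universe M" "map h (map ?g ys) = ys" if "set ys \<subseteq> universe N" for ys
    using that g by (auto intro!: map_idI)
  show ?thesis unfolding is_iso_def
  proof (intro conjI ballI allI impI)
    show "bij_betw ?g (universe N) (universe M)" using bij by (rule bij_betw_inv_into)
  next
    fix f ys assume f: "f \<in> funs L" and ys: "length ys = fun_arity L f \<and> set ys \<subseteq> universe N"
    then have "h (fun_interp M f (map ?g ys)) = fun_interp N f ys"
      using iso mp[of ys] unfolding is_iso_def by (metis length_map)
    moreover have "fun_interp M f (map ?g ys) \<in> universe M"
      using M f ys mp[of ys] unfolding is_structure_def by (metis length_map)
    ultimately show "?g (fun_interp N f ys) = fun_interp M f (map ?g ys)"
      using inj by (metis inv_into_f_f)
  next
    fix r ys assume r: "r \<in> rels L" and ys: "length ys = rel_arity L r \<and> set ys \<subseteq> universe N"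
    then show "rel_interp N r ys \<longleftrightarrow> rel_interp M r (map ?g ys)"
      using iso mp[of ys] unfolding is_iso_def by (metis length_map)
  qed
qed

lemma is_iso_trans:
  assumes "is_iso L h M N" "is_iso L k N K"
  shows "is_iso L (k \<circ> h) M K"
proof -
  have sub: "set (map h xs) \<subseteq> universe N" if "set xs \<subseteq> universe M" for xs
    using assms(1) that unfolding is_iso_def bij_betw_def by auto
  show ?thesis unfolding is_iso_def
  proof (intro conjI ballI allI impI)
    show "bij_betw (k \<circ> h) (universe M) (universe K)"
      using assms unfolding is_iso_def by (blast intro: bij_betw_trans)
  next
    fix f xs assume "f \<in> funs L" "length xs = fun_arity L f \<and> set xs \<subseteq> universe M"
    then show "(k \<circ> h) (fun_interp M f xs) = fun_interp K f (map (k \<circ> h) xs)"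
      using assms sub[of xs] unfolding is_iso_def by (metis comp_apply length_map list.map_comp)
  next
    fix r xs assume "r \<in> rels L" "length xs = rel_arity L r \<and> set xs \<subseteq> universe M"
    then show "rel_interp M r xs \<longleftrightarrow> rel_interp K r (map (k \<circ> h) xs)"
      using assms sub[of xs] unfolding is_iso_def by (metis length_map list.map_comp)
  qed
qed

lemma isomorphic_sym: "is_structure L M \<Longrightarrow> isomorphic L M N \<Longrightarrow> isomorphic L N M"
  unfolding isomorphic_def using is_iso_sym by blast

lemma isomorphic_trans: "isomorphic L M N \<Longrightarrow> isomorphic L N K \<Longrightarrow> isomorphic L M K"
  unfolding isomorphic_def using is_iso_trans by blast

lemma term_val_in:
  assumes M: "is_structure L M" and e: "range e \<subseteq> universe M"
  shows "term_of_lang L t \<Longrightarrow> term_val M e t \<in> universe M"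
proof (induction t)
  case (Var v)
  then show ?case using e by auto
next
  case (Fun f ts)
  then have "set (map (term_val M e) ts) \<subseteq> universe M" by (auto simp: list_all_iff)
  then show ?case using M Fun.prems unfolding is_structure_def by simp
qed

lemma iso_term_val:
  assumes M: "is_structure L M" and iso: "is_iso L h M N" and e: "range e \<subseteq> universe M"
  shows "term_of_lang L t \<Longrightarrow> h (term_val M e t) = term_val N (\<lambda>v. h (e v)) t"
proof (induction t)
  case (Var v)
  then show ?case by simp
next
  case (Fun f ts)
  then have "set (map (term_val M e) ts) \<subseteq> universe M"
    using term_val_in[OF M e] by (auto simp: list_all_iff)
  then have "h (fun_interp M f (map (term_val M e) ts))
           = fun_interp N f (map h (map (term_val M e) ts))"
    using iso Fun.prems unfolding is_iso_def by simp
  also have "map h (map (term_val M e) ts) = map (term_val N (\<lambda>v. h (e v))) ts"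
    using Fun by (auto simp: list_all_iff)
  finally show ?case by simp
qed

lemma iso_sat:
  assumes M: "is_structure L M" and iso: "is_iso L h M N"
  shows "form_of_lang L p \<Longrightarrow> range e \<subseteq> universe M \<Longrightarrow> sat M e p \<longleftrightarrow> sat N (\<lambda>v. h (e v)) p"
proof (induction p arbitrary: e)
  case (Equal s t)
  have "inj_on h (universe M)" using iso unfolding is_iso_def bij_betw_def by blast
  then have "term_val M e s = term_val M e t \<longleftrightarrow> h (term_val M e s) = h (term_val M e t)"
    using Equal term_val_in[OF M Equal.prems(2)] by (auto dest: inj_onD)
  then show ?case using Equal iso_term_val[OF M iso Equal.prems(2)] by simp
next
  case (Rel r ts)
  have "set (map (term_val M e) ts) \<subseteq> universe M"
    using Rel term_val_in[OF M Rel.prems(2)] by (auto simp: list_all_iff)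
  then have "rel_interp M r (map (term_val M e) ts)
         \<longleftrightarrow> rel_interp N r (map h (map (term_val M e) ts))"
    using iso Rel.prems unfolding is_iso_def by simp
  also have "map h (map (term_val M e) ts) = map (term_val N (\<lambda>v. h (e v))) ts"
    using Rel iso_term_val[OF M iso Rel.prems(2)] by (auto simp: list_all_iff)
  finally show ?case by simp
next
  case (Exists v p)
  have img: "universe N = h ` universe M" using iso unfolding is_iso_def bij_betw_def by blast
  have "sat M (e(v := a)) p \<longleftrightarrow> sat N ((\<lambda>v. h (e v))(v := h a)) p" if "a \<in> universe M" for a
  proof -
    have "range (e(v := a)) \<subseteq> universe M" using that Exists.prems by auto
    moreover have "(\<lambda>w. h ((e(v := a)) w)) = (\<lambda>v. h (e v))(v := h a)" by auto
    moreover have "form_of_lang L p" using Exists.prems by simp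
    ultimately show ?thesis using Exists.IH[of "e(v := a)"] by (simp only: simp_thms)
  qed
  then show ?case using img by auto
qed auto

lemma iso_models:
  assumes M: "is_structure L M" and iso: "is_iso L h M N" and p: "form_of_lang L p"
  shows "models M p \<longleftrightarrow> models N p"
proof -
  let ?g = "inv_into (universe M) h"
  have img: "universe N = h ` universe M" using iso unfolding is_iso_def bij_betw_def by blast
  show ?thesis
  proof
    assume m: "models M p"
    show "models N p" unfolding models_def
    proof (intro allI impI)
      fix e :: "nat \<Rightarrow> _" assume e: "range e \<subseteq> universe N"
      then have "range (\<lambda>v. ?g (e v)) \<subseteq> universe M" using img by (auto intro!: inv_into_into)
      moreover have "(\<lambda>v. h (?g (e v))) = e"
      proof
        fix v
        have "e v \<in> h ` universe M" using e img by auto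
        then show "h (?g (e v)) = e v" by (rule f_inv_into_f)
      qed
      ultimately show "sat N e p" using m iso_sat[OF M iso p, of "\<lambda>v. ?g (e v)"]
        unfolding models_def by auto
    qed
  next
    assume m: "models N p"
    show "models M p" unfolding models_def
    proof (intro allI impI)
      fix e :: "nat \<Rightarrow> _" assume e: "range e \<subseteq> universe M"
      then have "range (\<lambda>v. h (e v)) \<subseteq> universe N" using img by auto
      then show "sat M e p" using m iso_sat[OF M iso p e] unfolding models_def by auto
    qed
  qed
qed

lemma iso_ultrapower:
  assumes M: "is_structure L M" and N: "is_structure L N" and iso: "is_iso L h M N"
  shows "isomorphic L (ultrapower U M) (ultrapower U N)"
proof -
  let ?CM = "ultra_carrier U (universe M)" and ?CN = "ultra_carrier U (universe N)"
  let ?k = "\<lambda>c. ultra_rel U (universe N) `` {\<lambda>i. h (ultra_rep c i)}"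
  have img: "h ` universe M = universe N" and inj: "inj_on h (universe M)"
    using iso unfolding is_iso_def bij_betw_def by auto
  have hrep: "h (ultra_rep c i) \<in> universe N" if "c \<in> ?CM" for c i
    using ultra_rep_range[OF that] img by blast
  have krep: "eventually (\<lambda>i. ultra_rep (?k c) i = h (ultra_rep c i)) U" if "c \<in> ?CM" for c
    by (rule ultra_rep_class) (rule hrep[OF that])
  have kmap: "eventually (\<lambda>i. map (\<lambda>d. ultra_rep d i) (map ?k cs)
                           = map h (map (\<lambda>c. ultra_rep c i) cs)) U"
    if "set cs \<subseteq> ?CM" for cs
  proof -
    have "eventually (\<lambda>i. \<forall>c\<in>set cs. ultra_rep (?k c) i = h (ultra_rep c i)) U"
      using that krep by (intro eventually_ball_finite) auto
    then show ?thesis by eventually_elim simp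
  qed
  have kin: "?k c \<in> ?CN" if "c \<in> ?CM" for c
    by (rule ultra_class_in) (rule hrep[OF that])
  have "is_iso L ?k (ultrapower U M) (ultrapower U N)"
    unfolding is_iso_def
  proof (intro conjI ballI allI impI)
    have "inj_on ?k ?CM"
    proof (rule inj_onI)
      fix c d assume cd: "c \<in> ?CM" "d \<in> ?CM" "?k c = ?k d"
      have "eventually (\<lambda>i. ultra_rep c i = ultra_rep d i) U"
        using krep[OF cd(1)] krep[OF cd(2)] unfolding cd(3)
        by eventually_elim (metis cd(1,2) inj inj_onD ultra_rep_range)
      then have "ultra_rel U (universe M) `` {ultra_rep c} = ultra_rel U (universe M) `` {ultra_rep d}"
        using cd by (intro ultra_class_eqI) (auto intro: ultra_rep_range)
      then show "c = d" using cd by (simp add: ultra_class_rep)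
    qed
    moreover have "d \<in> ?k ` ?CM" if d: "d \<in> ?CN" for d
    proof -
      let ?x = "\<lambda>i. inv_into (universe M) h (ultra_rep d i)"
      have x: "?x i \<in> universe M" "h (?x i) = ultra_rep d i" for i
        using ultra_rep_range[OF d, of i] img by (auto intro: inv_into_into f_inv_into_f)
      let ?c = "ultra_rel U (universe M) `` {?x}"
      have c: "?c \<in> ?CM" by (rule ultra_class_in) (rule x)
      have "eventually (\<lambda>i. ultra_rep ?c i = ?x i) U" by (rule ultra_rep_class) (rule x)
      then have "eventually (\<lambda>i. h (ultra_rep ?c i) = ultra_rep d i) U"
        by eventually_elim (simp add: x)
      then have "?k ?c = ultra_rel U (universe N) `` {ultra_rep d}"
        using hrep[OF c] ultra_rep_range[OF d] by (intro ultra_class_eqI) auto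
      then have "?k ?c = d" using ultra_class_rep[OF d] by simp
      then show ?thesis using c by blast
    qed
    ultimately show "bij_betw ?k (universe (ultrapower U M)) (universe (ultrapower U N))"
      unfolding bij_betw_def universe_ultrapower using kin by blast
  next
    fix f cs
    assume f: "f \<in> funs L"
      and "length cs = fun_arity L f \<and> set cs \<subseteq> universe (ultrapower U M)"
    then have l: "length cs = fun_arity L f" and cs: "set cs \<subseteq> ?CM" by auto
    let ?x = "\<lambda>i. fun_interp M f (map (\<lambda>c. ultra_rep c i) cs)"
    have rep: "set (map (\<lambda>c. ultra_rep c i) cs) \<subseteq> universe M" for i
      using cs by (auto intro: ultra_rep_range)
    have x: "?x i \<in> universe M" for i
      using M f l rep[of i] unfolding is_structure_def by simp
    have hx: "h (?x i) = fun_interp N f (map h (map (\<lambda>c. ultra_rep c i) cs))" for i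
      using iso f l rep[of i] unfolding is_iso_def by simp
    let ?c = "ultra_rel U (universe M) `` {?x}"
    have c: "?c \<in> ?CM" by (rule ultra_class_in) (rule x)
    have ev: "eventually (\<lambda>i. ultra_rep ?c i = ?x i) U" by (rule ultra_rep_class) (rule x)
    have kcs: "set (map (\<lambda>d. ultra_rep d i) (map ?k cs)) \<subseteq> universe N" for i
      using cs kin by (auto intro!: ultra_rep_range[where U=U])
    have "?k ?c = ultra_rel U (universe N) ``
            {\<lambda>i. fun_interp N f (map (\<lambda>d. ultra_rep d i) (map ?k cs))}"
    proof (rule ultra_class_eqI)
      show "h (ultra_rep ?c i) \<in> universe N" for i by (rule hrep[OF c])
      show "fun_interp N f (map (\<lambda>d. ultra_rep d i) (map ?k cs)) \<in> universe N" for i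
        using N f l kcs[of i] unfolding is_structure_def by simp
      show "eventually (\<lambda>i. h (ultra_rep ?c i)
              = fun_interp N f (map (\<lambda>d. ultra_rep d i) (map ?k cs))) U"
        using ev kmap[OF cs] by eventually_elim (simp only: hx)
    qed
    then show "?k (fun_interp (ultrapower U M) f cs) = fun_interp (ultrapower U N) f (map ?k cs)"
      unfolding ultrapower_def fo_structure.simps .
  next
    fix r cs
    assume r: "r \<in> rels L"
      and "length cs = rel_arity L r \<and> set cs \<subseteq> universe (ultrapower U M)"
    then have l: "length cs = rel_arity L r" and cs: "set cs \<subseteq> ?CM" by auto
    have rep: "set (map (\<lambda>c. ultra_rep c i) cs) \<subseteq> universe M" for i
      using cs by (auto intro: ultra_rep_range)
    have hr: "rel_interp M r (map (\<lambda>c. ultra_rep c i) cs)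
          \<longleftrightarrow> rel_interp N r (map h (map (\<lambda>c. ultra_rep c i) cs))" for i
      using iso r l rep[of i] unfolding is_iso_def by simp
    have "eventually (\<lambda>i. rel_interp M r (map (\<lambda>c. ultra_rep c i) cs)
           = rel_interp N r (map (\<lambda>d. ultra_rep d i) (map ?k cs))) U"
      using kmap[OF cs] by eventually_elim (simp only: hr)
    then show "rel_interp (ultrapower U M) r cs \<longleftrightarrow> rel_interp (ultrapower U N) r (map ?k cs)"
      unfolding ultrapower_def fo_structure.simps by (rule eventually_subst)
  qed
  then show ?thesis unfolding isomorphic_def by blast
qed

definition rename_structure ::
  "('g \<Rightarrow> 'f) \<Rightarrow> ('s \<Rightarrow> 'r) \<Rightarrow> ('f, 'r, 'a) fo_structure \<Rightarrow> ('g, 's, 'a) fo_structure" where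
  "rename_structure u v M =
    \<lparr> universe = universe M, fun_interp = (\<lambda>f. fun_interp M (u f)),
      rel_interp = (\<lambda>r. rel_interp M (v r)) \<rparr>"

lemma universe_rename [simp]: "universe (rename_structure u v M) = universe M"
  by (simp add: rename_structure_def)

lemma interp_rename [simp]:
  "fun_interp (rename_structure u v M) f = fun_interp M (u f)"
  "rel_interp (rename_structure u v M) r = rel_interp M (v r)"
  by (simp_all add: rename_structure_def)

lemma ultrapower_rename:
  "ultrapower U (rename_structure u v M) = rename_structure u v (ultrapower U M)"
  by (simp add: rename_structure_def ultrapower_def)

lemma term_val_rename: "term_val (rename_structure u v M) e t = term_val M e (map_fo_term u t)"
proof (induction t)
  case (Fun f ts)
  then have "map (term_val (rename_structure u v M) e) ts = map (term_val M e \<circ> map_fo_term u) ts"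
    by simp
  then show ?case by (simp del: map_eq_conv)
qed simp

lemma sat_rename: "sat (rename_structure u v M) e p \<longleftrightarrow> sat M e (map_fo_form u v p)"
proof (induction p arbitrary: e)
  case (Rel r ts)
  have "map (term_val (rename_structure u v M) e) ts = map (term_val M e \<circ> map_fo_term u) ts"
    by (simp add: term_val_rename)
  then show ?case by (simp del: map_eq_conv)
qed (simp_all add: term_val_rename)

lemma models_rename: "models (rename_structure u v M) p \<longleftrightarrow> models M (map_fo_form u v p)"
  by (simp add: models_def sat_rename)

lemma term_vars_map: "term_vars (map_fo_term u t) = term_vars t"
  by (induction t) auto

lemma free_vars_map: "free_vars (map_fo_form u v p) = free_vars p"
  by (induction p) (auto simp: term_vars_map)

definition rename_language ::
  "('f \<Rightarrow> 'g) \<Rightarrow> ('r \<Rightarrow> 's) \<Rightarrow> ('f, 'r) language \<Rightarrow> ('g, 's) language" where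
  "rename_language a b L =
    \<lparr> funs = a ` funs L, rels = b ` rels L,
      fun_arity = (\<lambda>g. fun_arity L (inv_into (funs L) a g)),
      rel_arity = (\<lambda>s. rel_arity L (inv_into (rels L) b s)) \<rparr>"

text \<open>\<open>KT \<kappa>\<close> covers all countable languages and all structures of size at most \<open>\<kappa>\<close>.\<close>

lemma KT_general:
  fixes L :: "('f, 'r) language" and \<kappa> :: "'a rel"
    and A :: "('f, 'r, 'b) fo_structure" and B :: "('f, 'r, 'c) fo_structure"
  assumes KT: "KT \<kappa>" and \<kappa>: "Card_order \<kappa>" and L: "countable_language L"
    and A: "is_structure L A" and B: "is_structure L B"
    and sA: "|universe A| \<le>o \<kappa>" and sB: "|universe B| \<le>o \<kappa>"
    and AB: "elem_equiv L A B"
  shows "\<exists>U :: nat filter. nonprincipal_ultrafilter U \<and>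
           isomorphic L (ultrapower U A) (ultrapower U B)"
proof -
  define a where "a = to_nat_on (funs L)"
  define b where "b = to_nat_on (rels L)"
  define u where "u = inv_into (funs L) a"
  define v where "v = inv_into (rels L) b"
  have inj: "inj_on a (funs L)" "inj_on b (rels L)"
    using L unfolding a_def b_def countable_language_def by auto
  have ua: "u (a f) = f" if "f \<in> funs L" for f
    unfolding u_def using that inj by simp
  have vb: "v (b r) = r" if "r \<in> rels L" for r
    unfolding v_def using that inj by simp
  define L' where "L' = rename_language a b L"
  have L'_sel: "funs L' = a ` funs L" "rels L' = b ` rels L"
    "fun_arity L' = (\<lambda>g. fun_arity L (u g))" "rel_arity L' = (\<lambda>s. rel_arity L (v s))"
    unfolding L'_def rename_language_def u_def v_def by simp_all
  have cL': "countable_language L'"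
    unfolding countable_language_def by auto
  have tL': "term_of_lang L (map_fo_term u t)" if "term_of_lang L' t" for t
    using that by (induction t) (auto simp: L'_sel ua list_all_iff)
  have fL': "form_of_lang L (map_fo_form u v p)" if "form_of_lang L' p" for p
    using that by (induction p) (auto simp: L'_sel ua vb list_all_iff tL')
  have strL': "is_structure L' (rename_structure u v M)" if "is_structure L M"
    for M :: "('f, 'r, 'd) fo_structure"
    using that unfolding is_structure_def L'_sel by (auto simp: ua rename_structure_def)
  have isoL': "isomorphic L M N"
    if "isomorphic L' (rename_structure u v M) (rename_structure u v N)"
    for M :: "('f, 'r, 'd) fo_structure" and N :: "('f, 'r, 'e) fo_structure"
  proof -
    from that obtain h where "is_iso L' h (rename_structure u v M) (rename_structure u v N)"
      unfolding isomorphic_def by blast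
    then have "is_iso L h M N"
      unfolding is_iso_def L'_sel by (auto simp: ua vb rename_structure_def)
    then show ?thesis unfolding isomorphic_def by blast
  qed
  have copy: "\<exists>(M' :: ('f, 'r, 'a) fo_structure) h. is_structure L M' \<and> is_iso L h M M' \<and>
                |universe M'| \<le>o \<kappa>"
    if M: "is_structure L M" and s: "|universe M| \<le>o \<kappa>"
    for M :: "('f, 'r, 'd) fo_structure"
  proof -
    have "|universe M| \<le>o |Field \<kappa>|"
      using s card_of_Field_ordIso[OF \<kappa>] ordIso_symmetric ordLeq_ordIso_trans by blast
    then obtain h :: "'d \<Rightarrow> 'a" where h: "inj_on h (universe M)"
      using card_of_ordLeq[of "universe M" "Field \<kappa>"] by blast
    let ?g = "inv_into (universe M) h"
    define M' :: "('f, 'r, 'a) fo_structure" where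
      "M' = \<lparr> universe = h ` universe M,
              fun_interp = (\<lambda>f xs. h (fun_interp M f (map ?g xs))),
              rel_interp = (\<lambda>r xs. rel_interp M r (map ?g xs)) \<rparr>"
    have gh: "map ?g (map h xs) = xs" if "set xs \<subseteq> universe M" for xs
      using that h by (auto intro!: map_idI simp: subset_iff)
    have "is_structure L M'"
      unfolding is_structure_def
    proof (intro conjI ballI allI impI)
      show "universe M' \<noteq> {}" using M unfolding M'_def is_structure_def by simp
    next
      fix f xs assume f: "f \<in> funs L" and xs: "length xs = fun_arity L f \<and> set xs \<subseteq> universe M'"
      then have "set (map ?g xs) \<subseteq> universe M"
        unfolding M'_def by (auto intro!: inv_into_into)
      then have "fun_interp M f (map ?g xs) \<in> universe M"
        using M f xs unfolding is_structure_def by simp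
      then show "fun_interp M' f xs \<in> universe M'" unfolding M'_def by simp
    qed
    moreover have "is_iso L h M M'"
      unfolding is_iso_def M'_def fo_structure.simps
      using h gh by (simp add: bij_betw_def del: map_map)
    moreover have "|universe M'| \<le>o \<kappa>"
      unfolding M'_def using ordLeq_transitive[OF card_of_image s] by simp
    ultimately show ?thesis by blast
  qed
  obtain A' :: "('f, 'r, 'a) fo_structure" and h
    where A': "is_structure L A'" "is_iso L h A A'" "|universe A'| \<le>o \<kappa>"
    using copy[OF A sA] by blast
  obtain B' :: "('f, 'r, 'a) fo_structure" and k
    where B': "is_structure L B'" "is_iso L k B B'" "|universe B'| \<le>o \<kappa>"
    using copy[OF B sB] by blast
  have "elem_equiv L' (rename_structure u v A') (rename_structure u v B')"
    unfolding elem_equiv_def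
  proof
    fix p assume "p \<in> sentences L'"
    then have p: "form_of_lang L (map_fo_form u v p)" "map_fo_form u v p \<in> sentences L"
      unfolding sentences_def using fL' by (auto simp: free_vars_map)
    then have "models A (map_fo_form u v p) \<longleftrightarrow> models B (map_fo_form u v p)"
      using AB unfolding elem_equiv_def by blast
    then show "models (rename_structure u v A') p \<longleftrightarrow> models (rename_structure u v B') p"
      unfolding models_rename
      using iso_models[OF A A'(2) p(1)] iso_models[OF B B'(2) p(1)] by simp
  qed
  then obtain U :: "nat filter" where U: "nonprincipal_ultrafilter U"
    and iso: "isomorphic L' (ultrapower U (rename_structure u v A'))
                (ultrapower U (rename_structure u v B'))"
    using KT cL' strL'[OF A'(1)] strL'[OF B'(1)] A'(3) B'(3) unfolding KT_def
    by (metis universe_rename)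
  have 1: "isomorphic L (ultrapower U A) (ultrapower U A')"
    using A A'(1,2) by (rule iso_ultrapower)
  have 2: "isomorphic L (ultrapower U A') (ultrapower U B')"
    using iso unfolding ultrapower_rename by (rule isoL')
  have 3: "isomorphic L (ultrapower U B') (ultrapower U B)"
    by (rule isomorphic_sym[OF is_structure_ultrapower[OF B] iso_ultrapower[OF B B'(1,2)]])
  show ?thesis
    using U isomorphic_trans[OF isomorphic_trans[OF 1 2] 3] by (intro exI[of _ U] conjI)
qed

end

theory Submission
  imports Defs Complex_Main "HOL-Library.Countable_Set_Type"
begin

text \<open>
  Compare \<open>\<rat>\<close> with the lexicographic product \<open>\<omega>\<^sub>1 \<times> \<rat>\<close>. Both are dense linear orders without
  endpoints, hence elementarily equivalent by back and forth, so \<open>KT(\<aleph>\<^sub>1)\<close> makes their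
  ultrapowers by some \<open>U\<close> isomorphic. As \<open>\<omega>\<^sub>1\<close> is regular, the \<open>\<aleph>\<^sub>1\<close> many constant sequences are
  cofinal in the ultrapower of \<open>\<omega>\<^sub>1 \<times> \<rat>\<close>. Rounding up the isomorphic image of this family gives a
  cofinal family in \<open>\<omega>\<^sup>\<omega>/U\<close>. Conversely, diagonalization shows that a countable family is never
  cofinal in \<open>\<omega>\<^sup>\<omega>/U\<close>.
\<close>

section \<open>Dense linear orders without endpoints\<close>

text \<open>An explicit carrier and relation replace a type class, because the lexicographic order
  below depends on a well-order \<open>r\<close> and is considered only on
  \<open>Field r \<times> UNIV\<close>.\<close>

definition dense_order :: "'a set \<Rightarrow> ('a \<Rightarrow> 'a \<Rightarrow> bool) \<Rightarrow> bool" where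
  "dense_order S lt \<longleftrightarrow> S \<noteq> {} \<and>
     (\<forall>x\<in>S. \<not> lt x x) \<and>
     (\<forall>x\<in>S. \<forall>y\<in>S. \<forall>z\<in>S. lt x y \<longrightarrow> lt y z \<longrightarrow> lt x z) \<and>
     (\<forall>x\<in>S. \<forall>y\<in>S. x = y \<or> lt x y \<or> lt y x) \<and>
     (\<forall>x\<in>S. \<forall>y\<in>S. lt x y \<longrightarrow> (\<exists>z\<in>S. lt x z \<and> lt z y)) \<and>
     (\<forall>x\<in>S. (\<exists>y\<in>S. lt x y) \<and> (\<exists>y\<in>S. lt y x))"

lemma dense_orderD:
  assumes "dense_order S lt"
  shows "S \<noteq> {}"
    and "x \<in> S \<Longrightarrow> \<not> lt x x"
    and "x \<in> S \<Longrightarrow> y \<in> S \<Longrightarrow> z \<in> S \<Longrightarrow> lt x y \<Longrightarrow> lt y z \<Longrightarrow> lt x z"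
    and "x \<in> S \<Longrightarrow> y \<in> S \<Longrightarrow> x = y \<or> lt x y \<or> lt y x"
    and "x \<in> S \<Longrightarrow> y \<in> S \<Longrightarrow> lt x y \<Longrightarrow> \<exists>z\<in>S. lt x z \<and> lt z y"
    and "x \<in> S \<Longrightarrow> \<exists>y\<in>S. lt x y"
    and "x \<in> S \<Longrightarrow> \<exists>y\<in>S. lt y x"
  using assms unfolding dense_order_def by meson+

text \<open>The axioms are self-dual, so a statement about greatest elements also yields the one
  about least elements.\<close>

lemma dense_order_converse: "dense_order S lt \<Longrightarrow> dense_order S (\<lambda>x y. lt y x)"
  unfolding dense_order_def by blast

text \<open>By trichotomy, two assignments that agree on \<open>lt\<close> also agree on equality.
  Hence partial isomorphisms are described by \<open>lt\<close> alone.\<close>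

lemma dense_order_eq_iff:
  assumes "dense_order S lt" "x \<in> S" "y \<in> S"
  shows "x = y \<longleftrightarrow> \<not> lt x y \<and> \<not> lt y x"
  using dense_orderD(4)[OF assms] dense_orderD(2)[OF assms(1,2)] by blast

lemma dense_order_finite_greatest:
  assumes "dense_order S lt" "finite X" "X \<noteq> {}" "X \<subseteq> S"
  shows "\<exists>m\<in>X. \<forall>x\<in>X. x = m \<or> lt x m"
  using assms(2,3,4)
proof (induction X rule: finite_ne_induct)
  case (singleton x)
  then show ?case by simp
next
  case (insert x X)
  then obtain m where m: "m \<in> X" "\<forall>y\<in>X. y = m \<or> lt y m" by auto
  have S: "x \<in> S" "m \<in> S" "X \<subseteq> S" using insert.prems m by auto
  from dense_orderD(4)[OF assms(1) S(1,2)] consider "x = m \<or> lt x m" | "lt m x" by blast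
  then show ?case
  proof cases
    case 1
    then show ?thesis using m by blast
  next
    case 2
    have "lt y x" if "y \<in> X" for y
    proof -
      have "y \<in> S" using that S by blast
      then have "lt y m \<Longrightarrow> lt y x" using dense_orderD(3)[OF assms(1) _ S(2,1) _ 2] by blast
      then show ?thesis using bspec[OF m(2) that] 2 by auto
    qed
    then show ?thesis by blast
  qed
qed

text \<open>Only the greatest element of \<open>X\<close> and the least element of \<open>Y\<close>
  matter, and density separates them. If one set is empty, the lack of endpoints takes the place of
  density; if both are, nonemptiness of \<open>S\<close> suffices.\<close>

lemma dense_order_finite_between:
  assumes S: "dense_order S lt" and X: "finite X" "X \<subseteq> S" and Y: "finite Y" "Y \<subseteq> S"
    and XY: "\<And>x y. x \<in> X \<Longrightarrow> y \<in> Y \<Longrightarrow> lt x y"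
  shows "\<exists>b\<in>S. (\<forall>x\<in>X. lt x b) \<and> (\<forall>y\<in>Y. lt b y)"
proof -
  note trans = dense_orderD(3)[OF S]
  have up: "\<exists>m\<in>X. \<forall>b\<in>S. lt m b \<longrightarrow> (\<forall>x\<in>X. lt x b)" if ne: "X \<noteq> {}"
  proof -
    obtain m where m: "m \<in> X" "\<forall>x\<in>X. x = m \<or> lt x m"
      using dense_order_finite_greatest[OF S X(1) ne X(2)] by blast
    then have "\<forall>b\<in>S. lt m b \<longrightarrow> (\<forall>x\<in>X. lt x b)"
      using trans[OF subsetD[OF X(2)] subsetD[OF X(2)]] by fast
    then show ?thesis using m(1) by blast
  qed
  have down: "\<exists>m\<in>Y. \<forall>b\<in>S. lt b m \<longrightarrow> (\<forall>y\<in>Y. lt b y)" if ne: "Y \<noteq> {}"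
  proof -
    obtain m where m: "m \<in> Y" "\<forall>y\<in>Y. y = m \<or> lt m y"
      using dense_order_finite_greatest[OF dense_order_converse[OF S] Y(1) ne Y(2)] by blast
    then have "\<forall>b\<in>S. lt b m \<longrightarrow> (\<forall>y\<in>Y. lt b y)"
      using trans[OF _ subsetD[OF Y(2)] subsetD[OF Y(2)]] by fast
    then show ?thesis using m(1) by blast
  qed
  consider "X = {}" "Y = {}" | "X = {}" "Y \<noteq> {}" | "X \<noteq> {}" "Y = {}" | "X \<noteq> {}" "Y \<noteq> {}"
    by blast
  then show ?thesis
  proof cases
    case 1
    moreover obtain b where "b \<in> S" using dense_orderD(1)[OF S] by blast
    ultimately show ?thesis by blast
  next
    case 2
    then obtain m where "m \<in> Y" "\<forall>b\<in>S. lt b m \<longrightarrow> (\<forall>y\<in>Y. lt b y)" using down by blast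
    moreover from this obtain b where "b \<in> S" "lt b m"
      using dense_orderD(7)[OF S] Y(2) by blast
    ultimately show ?thesis using 2 by blast
  next
    case 3
    then obtain m where "m \<in> X" "\<forall>b\<in>S. lt m b \<longrightarrow> (\<forall>x\<in>X. lt x b)" using up by blast
    moreover from this obtain b where "b \<in> S" "lt m b"
      using dense_orderD(6)[OF S] X(2) by blast
    ultimately show ?thesis using 3 by blast
  next
    case 4
    then obtain l where l: "l \<in> X" "\<forall>b\<in>S. lt l b \<longrightarrow> (\<forall>x\<in>X. lt x b)" using up by blast
    from 4 obtain m where m: "m \<in> Y" "\<forall>b\<in>S. lt b m \<longrightarrow> (\<forall>y\<in>Y. lt b y)" using down by blast
    have "lt l m" "l \<in> S" "m \<in> S" using XY l m X Y by auto
    then obtain b where "b \<in> S" "lt l b" "lt b m"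
      using dense_orderD(5)[OF S] by blast
    then show ?thesis using l m by blast
  qed
qed

text \<open>The forth step of back and forth: \<open>e\<close> and \<open>e'\<close> describe a
  finite partial isomorphism, and \<open>b\<close> answers the new point \<open>a\<close>. If
  \<open>a = e i\<close>, take \<open>e' i\<close>. Otherwise the images of the points below
  \<open>a\<close> lie below the images of those above \<open>a\<close>, by transitivity through
  \<open>a\<close>, and \<open>b\<close> is put between them.\<close>

lemma dense_order_extension:
  assumes S: "dense_order S lt" and T: "dense_order T lt'" and W: "finite W"
    and e: "\<And>i. i \<in> W \<Longrightarrow> e i \<in> S" and e': "\<And>i. i \<in> W \<Longrightarrow> e' i \<in> T"
    and ee': "\<And>i j. i \<in> W \<Longrightarrow> j \<in> W \<Longrightarrow> lt (e i) (e j) \<longleftrightarrow> lt' (e' i) (e' j)"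
    and a: "a \<in> S"
  shows "\<exists>b\<in>T. \<forall>i\<in>W. (lt (e i) a \<longleftrightarrow> lt' (e' i) b) \<and> (lt a (e i) \<longleftrightarrow> lt' b (e' i))"
proof (cases "a \<in> e ` W")
  case True
  then show ?thesis using e' ee' by auto
next
  case False
  let ?X = "e' ` {i\<in>W. lt (e i) a}" and ?Y = "e' ` {i\<in>W. lt a (e i)}"
  have "\<exists>b\<in>T. (\<forall>x\<in>?X. lt' x b) \<and> (\<forall>y\<in>?Y. lt' b y)"
  proof (rule dense_order_finite_between[OF T])
    fix x y assume "x \<in> ?X" "y \<in> ?Y"
    then obtain i j where ij: "i \<in> W" "j \<in> W" "lt (e i) a" "lt a (e j)" "x = e' i" "y = e' j"
      by blast
    then have "lt (e i) (e j)" using dense_orderD(3)[OF S e[OF ij(1)] a e[OF ij(2)]] by blast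
    then show "lt' x y" using ij ee' by simp
  qed (use W e' in auto)
  then obtain b where b: "b \<in> T" "\<forall>x\<in>?X. lt' x b" "\<forall>y\<in>?Y. lt' b y" by blast
  \<comment> \<open>The choice of \<open>b\<close> gives only implications from \<open>S\<close> to
    \<open>T\<close>. They become equivalences because one of the two comparisons with
    \<open>a\<close> holds in \<open>S\<close> and they exclude each other in both orders.\<close>
  have asymS: "\<not> (lt x y \<and> lt y x)" if "x \<in> S" "y \<in> S" for x y
    using dense_orderD(2,3)[OF S] that by blast
  have asymT: "\<not> (lt' x y \<and> lt' y x)" if "x \<in> T" "y \<in> T" for x y
    using dense_orderD(2,3)[OF T] that by blast
  have "(lt (e i) a \<longleftrightarrow> lt' (e' i) b) \<and> (lt a (e i) \<longleftrightarrow> lt' b (e' i))" if i: "i \<in> W" for i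
  proof -
    have "lt (e i) a \<or> lt a (e i)"
      using dense_orderD(4)[OF S a e[OF i]] False i by blast
    moreover have "lt (e i) a \<Longrightarrow> lt' (e' i) b" "lt a (e i) \<Longrightarrow> lt' b (e' i)"
      using b i by auto
    ultimately show ?thesis using asymS[OF a e[OF i]] asymT[OF b(1) e'[OF i]] by blast
  qed
  then show ?thesis using b(1) by blast
qed

section \<open>Elementary equivalence by back and forth\<close>

definition order_language :: "(unit, unit) language" where
  "order_language =
    \<lparr> funs = {}, rels = UNIV, fun_arity = (\<lambda>_. 0), rel_arity = (\<lambda>_. 2) \<rparr>"

definition order_structure ::
  "'a set \<Rightarrow> ('a \<Rightarrow> 'a \<Rightarrow> bool) \<Rightarrow> (unit, unit, 'a) fo_structure" where
  "order_structure S lt =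
    \<lparr> universe = S, fun_interp = (\<lambda>_ _. undefined),
      rel_interp = (\<lambda>_ xs. lt (xs ! 0) (xs ! 1)) \<rparr>"

lemma order_structure_simps [simp]:
  "universe (order_structure S lt) = S"
  "rel_interp (order_structure S lt) r xs = lt (xs ! 0) (xs ! 1)"
  by (simp_all add: order_structure_def)

lemma is_structure_order: "S \<noteq> {} \<Longrightarrow> is_structure order_language (order_structure S lt)"
  by (simp add: is_structure_def order_language_def)

lemma order_term: "term_of_lang order_language t \<longleftrightarrow> (\<exists>v. t = Var v)"
  by (cases t) (auto simp: order_language_def)

text \<open>Induction on the formula, with an arbitrary finite \<open>V\<close> around the free
  variables: both parts of a conjunction can share it, and a quantifier can enlarge it. The
  quantifier case is \<open>dense_order_extension\<close>, applied in both directions.\<close>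

lemma dense_order_sat:
  assumes S: "dense_order S lt" and T: "dense_order T lt'"
  shows "form_of_lang order_language p \<Longrightarrow> finite V \<Longrightarrow> free_vars p \<subseteq> V \<Longrightarrow>
    \<forall>i\<in>V. e i \<in> S \<and> e' i \<in> T \<Longrightarrow>
    \<forall>i\<in>V. \<forall>j\<in>V. lt (e i) (e j) \<longleftrightarrow> lt' (e' i) (e' j) \<Longrightarrow>
    sat (order_structure S lt) e p \<longleftrightarrow> sat (order_structure T lt') e' p"
proof (induction p arbitrary: V e e')
  case (Equal s t)
  then obtain i j where ij: "s = Var i" "t = Var j" by (auto simp: order_term)
  have V: "i \<in> V" "j \<in> V" using Equal.prems ij by auto
  have in_ST: "e i \<in> S" "e j \<in> S" "e' i \<in> T" "e' j \<in> T"
    and lt: "lt (e i) (e j) \<longleftrightarrow> lt' (e' i) (e' j)" "lt (e j) (e i) \<longleftrightarrow> lt' (e' j) (e' i)"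
    using Equal.prems(4,5) V by blast+
  have "e i = e j \<longleftrightarrow> e' i = e' j"
    unfolding dense_order_eq_iff[OF S in_ST(1,2)] dense_order_eq_iff[OF T in_ST(3,4)] lt ..
  then show ?case by (simp add: ij)
next
  case (Rel r ts)
  then have "length ts = Suc (Suc 0)" "list_all (term_of_lang order_language) ts"
    by (simp_all add: order_language_def)
  then obtain i j where ij: "ts = [Var i, Var j]"
    by (auto simp: length_Suc_conv order_term)
  then have "i \<in> V" "j \<in> V" using Rel.prems by auto
  then show ?case using Rel.prems(5) by (simp add: ij)
next
  case (Neg p)
  have "sat (order_structure S lt) e p \<longleftrightarrow> sat (order_structure T lt') e' p"
    by (rule Neg.IH[OF _ Neg.prems(2) _ Neg.prems(4,5)])
      (use Neg.prems(1,3) in auto)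
  then show ?case by simp
next
  case (Conj p q)
  have "sat (order_structure S lt) e p \<longleftrightarrow> sat (order_structure T lt') e' p"
    by (rule Conj.IH(1)[OF _ Conj.prems(2) _ Conj.prems(4,5)])
      (use Conj.prems(1,3) in auto)
  moreover have "sat (order_structure S lt) e q \<longleftrightarrow> sat (order_structure T lt') e' q"
    by (rule Conj.IH(2)[OF _ Conj.prems(2) _ Conj.prems(4,5)])
      (use Conj.prems(1,3) in auto)
  ultimately show ?case by simp
next
  case (Exists v p)
  \<comment> \<open>The old values at \<open>v\<close> are overwritten, so \<open>a\<close> and
    \<open>b\<close> have to match only relative to the other variables.\<close>
  let ?W = "V - {v}"
  have step: "sat (order_structure S lt) (e(v := a)) p \<longleftrightarrow> sat (order_structure T lt') (e'(v := b)) p"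
    if a: "a \<in> S" and b: "b \<in> T"
      and ab: "\<forall>i\<in>?W. (lt (e i) a \<longleftrightarrow> lt' (e' i) b) \<and> (lt a (e i) \<longleftrightarrow> lt' b (e' i))" for a b
  proof (rule Exists.IH)
    show "form_of_lang order_language p" "finite (insert v V)" "free_vars p \<subseteq> insert v V"
      using Exists.prems(1-3) by auto
    show "\<forall>i\<in>insert v V. (e(v := a)) i \<in> S \<and> (e'(v := b)) i \<in> T"
      using Exists.prems(4) a b by (auto simp: fun_upd_apply)
    note irrefl = dense_orderD(2)[OF S a] dense_orderD(2)[OF T b]
    have "lt ((e(v := a)) i) ((e(v := a)) j) \<longleftrightarrow> lt' ((e'(v := b)) i) ((e'(v := b)) j)"
      if ij: "i \<in> insert v V" "j \<in> insert v V" for i j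
    proof -
      consider "i = v" "j = v" | "i = v" "j \<in> ?W" | "i \<in> ?W" "j = v" | "i \<in> ?W" "j \<in> ?W"
        using ij by blast
      then show ?thesis
      proof cases
        case 1
        then show ?thesis using irrefl by simp
      next
        case 2
        then show ?thesis using bspec[OF ab, of j] by simp
      next
        case 3
        then show ?thesis using bspec[OF ab, of i] by simp
      next
        case 4
        then show ?thesis using bspec[OF bspec[OF Exists.prems(5), of i], of j] by simp
      qed
    qed
    then show "\<forall>i\<in>insert v V. \<forall>j\<in>insert v V.
        lt ((e(v := a)) i) ((e(v := a)) j) \<longleftrightarrow> lt' ((e'(v := b)) i) ((e'(v := b)) j)" by blast
  qed
  have W: "finite ?W" "\<And>i. i \<in> ?W \<Longrightarrow> e i \<in> S" "\<And>i. i \<in> ?W \<Longrightarrow> e' i \<in> T"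
    using Exists.prems(2,4) by auto
  have W': "lt (e i) (e j) \<longleftrightarrow> lt' (e' i) (e' j)" if "i \<in> ?W" "j \<in> ?W" for i j
    using Exists.prems(5) that by blast
  have ex_T: "\<exists>b\<in>T. \<forall>i\<in>?W. (lt (e i) a \<longleftrightarrow> lt' (e' i) b) \<and> (lt a (e i) \<longleftrightarrow> lt' b (e' i))"
    if "a \<in> S" for a
    using S T W W' that by (rule dense_order_extension)
  \<comment> \<open>The back direction is the forth direction with the two orders exchanged.\<close>
  have ex_S: "\<exists>a\<in>S. \<forall>i\<in>?W. (lt' (e' i) b \<longleftrightarrow> lt (e i) a) \<and> (lt' b (e' i) \<longleftrightarrow> lt a (e i))"
    if "b \<in> T" for b
    by (rule dense_order_extension[OF T S W(1,3,2) W'[symmetric] that])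
  show ?case
  proof
    assume "sat (order_structure S lt) e (Exists v p)"
    then obtain a where a: "a \<in> S" "sat (order_structure S lt) (e(v := a)) p" by auto
    obtain b where b: "b \<in> T"
      "\<forall>i\<in>?W. (lt (e i) a \<longleftrightarrow> lt' (e' i) b) \<and> (lt a (e i) \<longleftrightarrow> lt' b (e' i))"
      using ex_T[OF a(1)] by blast
    then have "sat (order_structure T lt') (e'(v := b)) p" using step[OF a(1) b] a(2) by blast
    then show "sat (order_structure T lt') e' (Exists v p)" using b(1) by auto
  next
    assume "sat (order_structure T lt') e' (Exists v p)"
    then obtain b where b: "b \<in> T" "sat (order_structure T lt') (e'(v := b)) p" by auto
    obtain a where a: "a \<in> S"
      "\<forall>i\<in>?W. (lt' (e' i) b \<longleftrightarrow> lt (e i) a) \<and> (lt' b (e' i) \<longleftrightarrow> lt a (e i))"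
      using ex_S[OF b(1)] by blast
    then have "sat (order_structure S lt) (e(v := a)) p" using step[OF a(1) b(1)] b(2) by metis
    then show "sat (order_structure S lt) e (Exists v p)" using a(1) by auto
  qed
qed

lemma dense_order_elem_equiv:
  assumes S: "dense_order S lt" and T: "dense_order T lt'"
  shows "elem_equiv order_language (order_structure S lt) (order_structure T lt')"
  unfolding elem_equiv_def
proof
  fix p assume "p \<in> sentences order_language"
  then have p: "form_of_lang order_language p" "free_vars p = {}" unfolding sentences_def by auto
  \<comment> \<open>For a sentence \<open>V\<close> can be empty, so the conditions on
    \<open>e\<close> and \<open>e'\<close> are vacuous.\<close>
  have eq: "sat (order_structure S lt) e p \<longleftrightarrow> sat (order_structure T lt') e' p" for e e'
    by (rule dense_order_sat[OF S T p(1), of "{}"]) (simp_all add: p)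
  \<comment> \<open>\<open>models\<close> quantifies over all assignments into the universe;
    transferring it in either direction requires one assignment on the other side.\<close>
  obtain s t where "s \<in> S" "t \<in> T" using dense_orderD(1)[OF S] dense_orderD(1)[OF T] by blast
  then have "range (\<lambda>_::nat. s) \<subseteq> S" "range (\<lambda>_::nat. t) \<subseteq> T" by auto
  then show "models (order_structure S lt) p \<longleftrightarrow> models (order_structure T lt') p"
    unfolding models_def order_structure_simps using eq by meson
qed

section \<open>Rationals and lexicographic products of a well-order with them\<close>

lemma dense_order_rat: "dense_order (UNIV :: rat set) (<)"
  unfolding dense_order_def by (auto intro: dense lt_ex gt_ex)

text \<open>Well-orders are reflexive relations here, so the strict comparison of first coordinates
  has to exclude equality.\<close>

definition lex_rat_less :: "'a rel \<Rightarrow> 'a \<times> rat \<Rightarrow> 'a \<times> rat \<Rightarrow> bool" where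
  "lex_rat_less r x y \<longleftrightarrow>
     fst x \<noteq> fst y \<and> (fst x, fst y) \<in> r \<or> fst x = fst y \<and> snd x < snd y"

text \<open>Each point of \<open>r\<close> becomes a copy of \<open>\<rat>\<close>. A copy has no
  endpoints, so a point between two copies is found in the lower copy, just above the given
  point.\<close>

lemma dense_order_lex_rat:
  assumes r: "Well_order r" and ne: "Field r \<noteq> {}"
  shows "dense_order (Field r \<times> UNIV) (lex_rat_less r)"
proof -
  have tr: "trans r" and an: "antisym r" and to: "total_on (Field r) r"
    using r unfolding well_order_on_def linear_order_on_def partial_order_on_def preorder_on_def
    by auto
  show ?thesis unfolding dense_order_def
  proof (intro conjI ballI impI)
    show "Field r \<times> (UNIV :: rat set) \<noteq> {}" using ne by auto
  next
    fix x show "\<not> lex_rat_less r x x" by (simp add: lex_rat_less_def)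
  next
    fix x y z assume "lex_rat_less r x y" "lex_rat_less r y z"
    then show "lex_rat_less r x z"
      using transD[OF tr, of "fst x" "fst y" "fst z"] antisymD[OF an, of "fst x" "fst y"]
      unfolding lex_rat_less_def by auto
  next
    fix x y :: "'a \<times> rat" assume "x \<in> Field r \<times> UNIV" "y \<in> Field r \<times> UNIV"
    then have "fst x = fst y \<or> (fst x, fst y) \<in> r \<or> (fst y, fst x) \<in> r"
      using to unfolding total_on_def by (metis mem_Times_iff)
    then show "x = y \<or> lex_rat_less r x y \<or> lex_rat_less r y x"
      using linorder_less_linear[of "snd x" "snd y"] unfolding lex_rat_less_def prod_eq_iff by auto
  next
    fix x y :: "'a \<times> rat" assume x: "x \<in> Field r \<times> UNIV" and "lex_rat_less r x y"
    then consider "fst x \<noteq> fst y" "(fst x, fst y) \<in> r" | "fst x = fst y" "snd x < snd y"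
      unfolding lex_rat_less_def by blast
    then show "\<exists>z\<in>Field r \<times> UNIV. lex_rat_less r x z \<and> lex_rat_less r z y"
    proof cases
      case 1
      then show ?thesis using x
        by (intro bexI[of _ "(fst x, snd x + 1)"]) (auto simp: lex_rat_less_def)
    next
      case 2
      then obtain q where "snd x < q" "q < snd y" using dense by blast
      then show ?thesis using x 2
        by (intro bexI[of _ "(fst x, q)"]) (auto simp: lex_rat_less_def)
    qed
  next
    fix x :: "'a \<times> rat" assume x: "x \<in> Field r \<times> UNIV"
    show "\<exists>y\<in>Field r \<times> UNIV. lex_rat_less r x y"
      using x by (intro bexI[of _ "(fst x, snd x + 1)"]) (auto simp: lex_rat_less_def)
    show "\<exists>y\<in>Field r \<times> UNIV. lex_rat_less r y x"
      using x by (intro bexI[of _ "(fst x, snd x - 1)"]) (auto simp: lex_rat_less_def)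
  qed
qed

section \<open>Cofinality of ultrapowers of the natural numbers\<close>

text \<open>A countable range is smaller than \<open>r\<close>, hence not cofinal by regularity. As
  \<open>cofinal\<close> asks for strictly larger elements, its failure together with totality gives
  a weak bound.\<close>

lemma regular_countable_bounded:
  fixes x :: "nat \<Rightarrow> 'a"
  assumes r: "Card_order r" "regularCard r" and uncount: "natLeq <o r"
    and x: "\<And>n. x n \<in> Field r"
  shows "\<exists>a\<in>Field r. \<forall>n. x n = a \<or> (x n, a) \<in> r"
proof -
  have "|range x| \<le>o natLeq"
    by (simp flip: countable_card_le_natLeq)
  then have "|range x| <o r" using uncount by (rule ordLeq_ordLess_trans)
  then have "\<not> |range x| =o r" using not_ordLess_ordIso by blast
  moreover have "range x \<subseteq> Field r" using x by blast
  ultimately have "\<not> cofinal (range x) r" using r(2) unfolding regularCard_def by blast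
  then obtain a where a: "a \<in> Field r" "\<forall>n. a = x n \<or> (a, x n) \<notin> r"
    unfolding cofinal_def by blast
  have "total_on (Field r) r"
    using card_order_on_well_order_on[OF r(1)]
    unfolding well_order_on_def linear_order_on_def by blast
  then have "x n = a \<or> (x n, a) \<in> r" for n
    using a x[of n] a(2)[rule_format, of n] unfolding total_on_def by metis
  then show ?thesis using a(1) by blast
qed

text \<open>An ultrafilter that contains a singleton is principal. So every single point can be
  removed, and then finitely many.\<close>

lemma nonprincipal_eventually_ge:
  fixes U :: "nat filter"
  assumes U: "nonprincipal_ultrafilter U"
  shows "eventually (\<lambda>n. k \<le> n) U"
proof -
  have ne: "eventually (\<lambda>n. n \<noteq> i) U" for i
  proof (rule ccontr)
    assume "\<not> eventually (\<lambda>n. n \<noteq> i) U"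
    then have ev: "eventually (\<lambda>n. n = i) U"
      using U unfolding nonprincipal_ultrafilter_def ultrafilter_def by (metis (mono_tags))
    have "eventually P U \<longleftrightarrow> P i" for P
    proof
      assume "eventually P U"
      then have "eventually (\<lambda>n. P i) U" using ev by eventually_elim simp
      moreover have "U \<noteq> bot"
        using U unfolding nonprincipal_ultrafilter_def ultrafilter_def by blast
      ultimately show "P i" by (simp add: eventually_const_iff)
    next
      assume "P i"
      then show "eventually P U" using ev by (auto elim: eventually_mono)
    qed
    then have "U = principal {i}" by (simp add: filter_eq_iff eventually_principal)
    then show False using U unfolding nonprincipal_ultrafilter_def by blast
  qed
  have "eventually (\<lambda>n. \<forall>i\<in>{..<k}. n \<noteq> i) U"
    by (rule eventually_ball_finite) (auto intro: ne)
  then show ?thesis by eventually_elim (metis lessThan_iff not_le)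
qed

section \<open>Cofinal families in \<open>\<omega>\<^sup>\<omega>/U\<close>\<close>

definition cofinal_family :: "nat filter \<Rightarrow> (nat \<Rightarrow> nat) set set \<Rightarrow> bool" where
  "cofinal_family U X \<longleftrightarrow> X \<subseteq> ultra_carrier U UNIV \<and>
     (\<forall>a\<in>ultra_carrier U UNIV. \<exists>x\<in>X. a = x \<or> ultra_less U a x)"

text \<open>The whole carrier is a cofinal family, so the minimum defining \<open>cofinality\<close>
  is taken over a nonempty set of cardinals.\<close>

lemma cofinality_attained:
  shows "\<exists>X. cofinal_family U X \<and> cofinality (ultra_carrier U UNIV) (ultra_less U) = |X|"
    and "cofinal_family U X \<Longrightarrow> cofinality (ultra_carrier U UNIV) (ultra_less U) \<le>o |X|"
proof -
  let ?R = "{|X| | X. cofinal_family U X}"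
  have "cofinal_family U (ultra_carrier U UNIV)" unfolding cofinal_family_def by blast
  then have "min_card ?R \<in> ?R \<and> (\<forall>s\<in>?R. min_card ?R \<le>o s)"
    by (intro min_card) (auto simp: card_of_Card_order)
  moreover have "cofinality (ultra_carrier U UNIV) (ultra_less U) = min_card ?R"
    unfolding cofinality_def cofinal_family_def ..
  ultimately show "\<exists>X. cofinal_family U X \<and> cofinality (ultra_carrier U UNIV) (ultra_less U) = |X|"
    and "cofinal_family U X \<Longrightarrow> cofinality (ultra_carrier U UNIV) (ultra_less U) \<le>o |X|"
    by auto
qed

text \<open>Diagonalization: \<open>g\<close> exceeds the \<open>k\<close>-th member of a countable
  family at every \<open>n \<ge> k\<close>, and these \<open>n\<close> form a set in
  \<open>U\<close>.\<close>

lemma cofinal_family_uncountable: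
  assumes U: "nonprincipal_ultrafilter U" and X: "cofinal_family U X"
  shows "\<not> countable X"
proof
  assume count: "countable X"
  let ?C = "\<lambda>f. ultra_rel U UNIV `` {f :: nat \<Rightarrow> nat}"
  \<comment> \<open>\<open>from_nat_into\<close> also enumerates a finite \<open>X\<close>, with a
    default value at the surplus indices.\<close>
  define x where "x k = ultra_rep (from_nat_into X k)" for k
  \<comment> \<open>The index set \<open>{..n}\<close> is finite and nonempty, so \<open>Max\<close>
    is meaningful; \<open>Suc\<close> makes the domination strict.\<close>
  define g where "g n = Suc (Max ((\<lambda>k. x k n) ` {..n}))" for n
  have g: "x k n < g n" if "k \<le> n" for k n
    unfolding g_def less_Suc_eq_le using that by (intro Max_ge) auto
  have "?C g \<in> ultra_carrier U UNIV" by (rule ultra_class_in) simp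
  then obtain c where c: "c \<in> X" "?C g = c \<or> ultra_less U (?C g) c"
    using X unfolding cofinal_family_def by blast
  obtain k where k: "c = from_nat_into X k"
    using from_nat_into_surj[OF count c(1)] by metis
  have "c \<in> ultra_carrier U UNIV" using c(1) X unfolding cofinal_family_def by blast
  then have cx: "c = ?C (x k)" unfolding x_def k[symmetric] by (rule ultra_class_rep[symmetric])
  have "eventually (\<lambda>n. g n \<le> x k n) U"
  proof (cases "?C g = c")
    case True
    have "(g, g) \<in> ultra_rel U UNIV" unfolding ultra_rel_def by simp
    then have "g \<in> ?C (x k)" using True cx by blast
    then have "eventually (\<lambda>n. x k n = g n) U" unfolding ultra_rel_def by auto
    then show ?thesis by eventually_elim simp
  next
    case False
    then have "eventually (\<lambda>n. g n < x k n) U" using c(2) unfolding cx ultra_less_class by blast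
    then show ?thesis by eventually_elim simp
  qed
  then have "eventually (\<lambda>n. False) U"
    using nonprincipal_eventually_ge[OF U, of k] by eventually_elim (use g leD in blast)
  then show False
    using U unfolding nonprincipal_ultrafilter_def ultrafilter_def by (simp add: trivial_limit_def)
qed

lemma cofinality_ge_aleph1:
  assumes "nonprincipal_ultrafilter U"
  shows "cardSuc natLeq \<le>o cofinality (ultra_carrier U UNIV) (ultra_less U)"
proof -
  obtain X where X: "cofinal_family U X"
    and eq: "cofinality (ultra_carrier U UNIV) (ultra_less U) = |X|"
    using cofinality_attained(1) by blast
  have "\<not> |X| \<le>o natLeq"
    using cofinal_family_uncountable[OF assms X] unfolding countable_card_le_natLeq .
  then have "natLeq <o |X|"
    using not_ordLeq_iff_ordLess[OF natLeq_Well_order card_of_Well_order] by blast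
  then show ?thesis
    unfolding eq using cardSuc_least[OF natLeq_Card_order card_of_Card_order] by blast
qed

text \<open>By regularity, the classes \<open>c a\<close> of constant sequences are cofinal in the
  ultrapower of the lexicographic product. Their images under \<open>h\<close> are cofinal in
  \<open>\<rat>\<^sup>\<omega>/U\<close>, and rounding representatives up turns them into at most
  \<open>r\<close> many classes cofinal in \<open>\<omega>\<^sup>\<omega>/U\<close>.\<close>

lemma isomorphic_rat_cofinality:
  assumes r: "Card_order r" "regularCard r" "natLeq <o r"
    and iso: "is_iso order_language h
      (ultrapower U (order_structure (Field r \<times> UNIV) (lex_rat_less r)))
      (ultrapower U (order_structure (UNIV :: rat set) (<)))"
  shows "cofinality (ultra_carrier U UNIV) (ultra_less U) \<le>o r"
proof -
  let ?S = "Field r \<times> (UNIV :: rat set)"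
  let ?B = "order_structure ?S (lex_rat_less r)" and ?A = "order_structure (UNIV :: rat set) (<)"
  let ?CB = "ultra_carrier U ?S" and ?CA = "ultra_carrier U (UNIV :: rat set)"
  define c where "c a = ultra_rel U ?S `` {\<lambda>_. (a, 0 :: rat)}" for a
  \<comment> \<open>\<open>nat\<close> sends negative ceilings to 0. This is harmless, since
    \<open>f a n\<close> is compared only where the rounded value exceeds a natural number.\<close>
  define f where "f a n = nat \<lceil>ultra_rep (h (c a)) n\<rceil> + 1" for a n
  define X where "X = (\<lambda>a. ultra_rel U UNIV `` {f a}) ` Field r"
  have cB: "c a \<in> ?CB" if "a \<in> Field r" for a
    unfolding c_def by (rule ultra_class_in) (use that in simp)
  have bij: "bij_betw h ?CB ?CA" using iso unfolding is_iso_def by simp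
  have rel: "rel_interp (ultrapower U ?B) () [x, y] \<longleftrightarrow> rel_interp (ultrapower U ?A) () [h x, h y]"
    if "x \<in> ?CB" "y \<in> ?CB" for x y
  proof -
    have "rel_interp (ultrapower U ?B) () [x, y]
      \<longleftrightarrow> rel_interp (ultrapower U ?A) () (map h [x, y])"
      using iso that unfolding is_iso_def
      by (elim conjE) (drule bspec[of _ _ "()"], auto simp: order_language_def)
    then show ?thesis by simp
  qed
  have "\<exists>x\<in>X. b = x \<or> ultra_less U b x" if b: "b \<in> ultra_carrier U UNIV" for b
  proof -
    \<comment> \<open>\<open>b\<close> is viewed inside the rational ultrapower and pulled back
      along \<open>h\<close> to \<open>d\<close>, which can be bounded by some
      \<open>c a\<close>.\<close>
    define q where "q n = rat_of_nat (ultra_rep b n)" for n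
    have "ultra_rel U UNIV `` {q} \<in> ?CA" by (rule ultra_class_in) simp
    then have "ultra_rel U UNIV `` {q} \<in> h ` ?CB" using bij unfolding bij_betw_def by simp
    then obtain d where d: "d \<in> ?CB" "h d = ultra_rel U UNIV `` {q}" by force
    have "fst (ultra_rep d n) \<in> Field r" for n using ultra_rep_range[OF d(1), of n] by auto
    then obtain a0 where a0: "a0 \<in> Field r"
      "\<forall>n. fst (ultra_rep d n) = a0 \<or> (fst (ultra_rep d n), a0) \<in> r"
      using regular_countable_bounded[OF r, of "\<lambda>n. fst (ultra_rep d n)"] by blast
    \<comment> \<open>The bound \<open>a0\<close> is weak, and a point over \<open>a0\<close> may
      lie above \<open>(a0, 0)\<close>. An infinite cardinal has no greatest element, so a strictly
      larger \<open>a\<close> exists, and \<open>(a, 0)\<close> lies above all values of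
      \<open>ultra_rep d\<close>.\<close>
    have "infinite (Field r)"
      using card_of_ordLeq_infinite[OF card_of_mono2[OF ordLess_imp_ordLeq[OF r(3)]]]
      by (simp add: Field_natLeq)
    then obtain a where a: "a \<in> Field r" "a0 \<noteq> a" "(a0, a) \<in> r"
      using infinite_Card_order_limit[OF r(1) _ a0(1)] by blast
    have wo: "trans r" "antisym r"
      using card_order_on_well_order_on[OF r(1)]
      unfolding well_order_on_def linear_order_on_def partial_order_on_def preorder_on_def by auto
    have lt: "lex_rat_less r (ultra_rep d n) (a, 0)" for n
      unfolding lex_rat_less_def fst_conv
      using a0(2)[rule_format, of n] a(2,3) antisymD[OF wo(2), of a0 a]
        transD[OF wo(1), of "fst (ultra_rep d n)" a0 a] by auto
    have "rel_interp (ultrapower U ?B) () [d, c a]"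
    proof -
      \<comment> \<open>Writing \<open>d\<close> as the class of its representative makes
        \<open>ultrapower_rel\<close> applicable; the comparison then holds at every index.\<close>
      have "rel_interp (ultrapower U ?B) ()
          (map (\<lambda>x. ultra_rel U (universe ?B) `` {x}) [ultra_rep d, \<lambda>_. (a, 0)])"
        by (subst ultrapower_rel) (use a(1) lt ultra_rep_range[OF d(1)] in auto)
      then show ?thesis using ultra_class_rep[OF d(1)] by (simp add: c_def)
    qed
    then have "rel_interp (ultrapower U ?A) () [h d, h (c a)]" using rel[OF d(1) cB[OF a(1)]] by blast
    moreover have "h (c a) \<in> ?CA" using bij cB[OF a(1)] unfolding bij_betw_def by blast
    ultimately have "rel_interp (ultrapower U ?A) ()
        (map (\<lambda>x. ultra_rel U (universe ?A) `` {x}) [q, ultra_rep (h (c a))])"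
      by (simp add: d ultra_class_rep)
    then have "eventually (\<lambda>n. q n < ultra_rep (h (c a)) n) U"
      by (subst (asm) ultrapower_rel) auto
    then have "eventually (\<lambda>n. ultra_rep b n < f a n) U"
    proof eventually_elim
      case (elim n)
      then show ?case unfolding q_def f_def by linarith
    qed
    then have "ultra_less U (ultra_rel U UNIV `` {ultra_rep b}) (ultra_rel U UNIV `` {f a})"
      unfolding ultra_less_class .
    then have "ultra_less U b (ultra_rel U UNIV `` {f a})" by (simp add: ultra_class_rep[OF b])
    then show ?thesis using a(1) unfolding X_def by blast
  qed
  then have "cofinal_family U X"
    unfolding cofinal_family_def X_def by (auto intro: ultra_class_in)
  then have "cofinality (ultra_carrier U UNIV) (ultra_less U) \<le>o |X|" by (rule cofinality_attained(2))
  also have "|X| \<le>o |Field r|" unfolding X_def by (rule card_of_image)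
  also have "|Field r| =o r" by (rule card_of_Field_ordIso[OF r(1)])
  finally show ?thesis .
qed

theorem theorem2p5:
  assumes "KT (cardSuc natLeq)"
  shows "mcf =o cardSuc natLeq"
proof -
  let ?r = "cardSuc natLeq"
  let ?S = "Field ?r \<times> (UNIV :: rat set)"
  let ?B = "order_structure ?S (lex_rat_less ?r)" and ?A = "order_structure (UNIV :: rat set) (<)"
  have r: "Card_order ?r" by (rule cardSuc_Card_order[OF natLeq_Card_order])
  have inf_nat: "infinite (Field natLeq)" by (simp add: Field_natLeq)
  have reg: "regularCard ?r"
    by (rule infinite_cardSuc_regularCard[OF inf_nat natLeq_Card_order])
  have less: "natLeq <o ?r" by (rule cardSuc_greater[OF natLeq_Card_order])
  have inf: "infinite (Field ?r)"
    using cardSuc_finite[OF natLeq_Card_order] inf_nat by blast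
  have rat: "|UNIV :: rat set| \<le>o ?r"
    by (rule ordLeq_transitive[OF _ ordLess_imp_ordLeq[OF less]])
      (simp flip: countable_card_le_natLeq)
  \<comment> \<open>An infinite cardinal absorbs the product with a countable set.\<close>
  have card: "|?S| \<le>o ?r"
    using card_of_Times_ordLeq_infinite_Field[OF inf _ rat r]
      ordIso_imp_ordLeq[OF card_of_Field_ordIso[OF r]] by blast
  have B: "dense_order ?S (lex_rat_less ?r)"
    using inf by (intro dense_order_lex_rat card_order_on_well_order_on[OF r]) auto
  \<comment> \<open>The structures have different element types and \<open>unit\<close> symbols,
    hence \<open>KT_general\<close> instead of the definition of \<open>KT\<close>.\<close>
  have "\<exists>U :: nat filter. nonprincipal_ultrafilter U \<and>
          isomorphic order_language (ultrapower U ?B) (ultrapower U ?A)"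
  proof (rule KT_general[OF assms r])
    show "countable_language order_language"
      by (simp add: countable_language_def order_language_def)
    show "is_structure order_language ?A" by (rule is_structure_order) simp
    show "is_structure order_language ?B"
      by (rule is_structure_order[OF dense_orderD(1)[OF B]])
    show "elem_equiv order_language ?B ?A" by (rule dense_order_elem_equiv[OF B dense_order_rat])
  qed (use card rat in simp_all)
  then obtain U :: "nat filter" and h where U: "nonprincipal_ultrafilter U"
    and h: "is_iso order_language h (ultrapower U ?B) (ultrapower U ?A)"
    unfolding isomorphic_def by blast
  let ?cf = "\<lambda>U. cofinality (ultra_carrier U UNIV) (ultra_less U)"
  let ?R = "{?cf U | U. nonprincipal_ultrafilter U}"
  have cardo: "Card_order (?cf V)" for V
    using cofinality_attained(1)[of V] card_of_Card_order by metis
  have m: "mcf \<in> ?R \<and> (\<forall>s\<in>?R. mcf \<le>o s)"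
    unfolding mcf_def by (rule min_card) (use U cardo in auto)
  \<comment> \<open>The upper bound comes from the \<open>U\<close> supplied by \<open>KT\<close>.
    The lower bound holds for every nonprincipal ultrafilter, in particular for one attaining the
    minimum.\<close>
  then have "mcf \<le>o ?cf U" using U by blast
  then have "mcf \<le>o ?r"
    using isomorphic_rat_cofinality[OF r reg less h] ordLeq_transitive by blast
  moreover have "?r \<le>o mcf"
  proof -
    obtain V where V: "mcf = ?cf V" "nonprincipal_ultrafilter V" using m by blast
    show ?thesis unfolding V(1) by (rule cofinality_ge_aleph1[OF V(2)])
  qed
  ultimately show ?thesis using ordIso_iff_ordLeq by blast
qed

end
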